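(* Let $F$ be a field, $n\ge 1$, and $N\in M_n(F)$ with $N^2=0$. Let $C = I_n - N$ and $A = N+N^T$, let $\phi_C(x) = \det(xC + C^T)$ and let $p_A(x)=\det(xI_n - A)$. Then \[ \phi_C(x^2) = x^n p_A(x+x^{-1}). \] *)

theory Defs
  imports
    "Jordan_Normal_Form.Char_Poly"
    "HOL-Computational_Algebra.Polynomial_Factorial"
begin

definition phi :: "'a :: field mat \<Rightarrow> 'a poly" where
  "phi C = det ([:0, 1:] \<cdot>\<^sub>m map_mat (\<lambda>a. [:a:]) C + map_mat (\<lambda>a. [:a:]) (transpose_mat C))"

text \<open>
  An identity involving both the indeterminate and its inverse is read in the field of rational
  functions \<open>F(x)\<close>, the fraction field of \<open>F[x]\<close>. It is not read pointwise in \<open>F\<close>, which would be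
  weaker over finite fields.
\<close>

definition ratfun_X :: "'a :: field poly fract" where
  "ratfun_X = to_fract [:0, 1:]"

definition subst_ratfun :: "'a :: field poly \<Rightarrow> 'a poly fract \<Rightarrow> 'a poly fract" where
  "subst_ratfun p u = poly (map_poly (\<lambda>a. to_fract [:a:]) p) u"

end

theory Submission
  imports Defs
begin

text \<open>
  If \<open>X\<^sup>2 = Y\<^sup>2 = 0\<close>, then \<open>(I - X) (I + X + Y) (I - Y) = I - X Y\<close>, and the outer factors have
  determinant \<open>1\<close>. Hence \<open>det (I + a N + b N\<^sup>T)\<close> depends on the scalars \<open>a\<close> and \<open>b\<close> only through
  \<open>a b\<close>. After division by \<open>x\<^sup>2 + 1\<close>, the two sides of the claim are the cases
  \<open>a = - x\<^sup>2 / (x\<^sup>2 + 1)\<close>, \<open>b = - 1 / (x\<^sup>2 + 1)\<close> and \<open>a = b = - x / (x\<^sup>2 + 1)\<close>.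
\<close>

lemma one_add_mult_one_minus_mat:
  fixes X :: "'a :: comm_ring_1 mat"
  assumes X: "X \<in> carrier_mat n n" and XX: "X * X = 0\<^sub>m n n"
  shows "(1\<^sub>m n + X) * (1\<^sub>m n - X) = 1\<^sub>m n"
proof -
  have "(1\<^sub>m n + X) * (1\<^sub>m n - X) = (1\<^sub>m n - X) + X * (1\<^sub>m n - X)"
    using X by (subst add_mult_distrib_mat[of _ n n]) (auto simp: minus_carrier_mat)
  also have "X * (1\<^sub>m n - X) = X"
    using X by (subst mult_minus_distrib_mat[of _ n n]) (auto simp: XX)
  also have "(1\<^sub>m n - X) + X = 1\<^sub>m n"
    using X by auto
  finally show ?thesis .
qed

text \<open>
  For an indeterminate \<open>y\<close>, the polynomial \<open>det (I + y X)\<close> is a unit, hence constant in \<open>y\<close>.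
\<close>

lemma det_one_add_square_zero:
  fixes X :: "'a :: idom mat"
  assumes X: "X \<in> carrier_mat n n" and XX: "X * X = 0\<^sub>m n n"
  shows "det (1\<^sub>m n + X) = 1"
proof -
  interpret C: comm_ring_hom "\<lambda>c :: 'a. [:c:]"
    by unfold_locales (auto simp: one_pCons)
  let ?X = "[:0, 1:] \<cdot>\<^sub>m map_mat (\<lambda>c. [:c:]) X"
  have Xc: "?X \<in> carrier_mat n n" using X by simp
  have "map_mat (\<lambda>c. [:c:]) X * map_mat (\<lambda>c. [:c:]) X = 0\<^sub>m n n"
    unfolding C.mat_hom_mult[OF X X, symmetric] XX by (intro eq_matI) auto
  then have "?X * ?X = 0\<^sub>m n n"
    using X by (subst mult_smult_assoc_mat[of _ n n _ n], simp, simp)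
      (subst mult_smult_distrib[of _ n n _ n], auto)
  then have "det (1\<^sub>m n + ?X) * det (1\<^sub>m n - ?X) = 1"
    using Xc one_add_mult_one_minus_mat[OF Xc]
    by (subst det_mult[symmetric, of _ n]) (auto simp: minus_carrier_mat)
  then have "det (1\<^sub>m n + ?X) dvd 1" by (metis dvdI)
  then obtain c where c: "det (1\<^sub>m n + ?X) = [:c:]" using is_unit_poly_iff by blast
  \<comment> \<open>Evaluation at \<open>t\<close> is a ring homomorphism, so it passes through
    \<open>det\<close>. At \<open>t = 0\<close> it identifies \<open>c\<close> as det I = 1; at
    \<open>t = 1\<close> it yields the claim.\<close>
  have ev: "poly (det (1\<^sub>m n + ?X)) t = det (1\<^sub>m n + t \<cdot>\<^sub>m X)" for t
    unfolding comm_ring_hom.hom_det[OF poly_hom.comm_ring_hom_axioms, symmetric] using X by (intro arg_cong[where f = det] eq_matI) auto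
  have "1\<^sub>m n + 0 \<cdot>\<^sub>m X = 1\<^sub>m n" "1\<^sub>m n + 1 \<cdot>\<^sub>m X = 1\<^sub>m n + X"
    using X by (auto intro!: eq_matI)
  then show ?thesis using ev[of 0] ev[of 1] c by simp
qed

lemma det_one_add_two_square_zero:
  fixes X Y :: "'a :: idom mat"
  assumes X: "X \<in> carrier_mat n n" and XX: "X * X = 0\<^sub>m n n"
    and Y: "Y \<in> carrier_mat n n" and YY: "Y * Y = 0\<^sub>m n n"
  shows "det (1\<^sub>m n + X + Y) = det (1\<^sub>m n - X * Y)"
proof -
  have inv: "det (1\<^sub>m n - Z) = 1" if Z: "Z \<in> carrier_mat n n" "Z * Z = 0\<^sub>m n n" for Z :: "'a mat"
    using arg_cong[OF one_add_mult_one_minus_mat[OF Z], of det] Z det_one_add_square_zero[OF Z]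
    by (subst (asm) det_mult[of _ n]) (auto simp: minus_carrier_mat)
  have XY: "X * Y \<in> carrier_mat n n" using X Y by simp
  \<comment> \<open>As \<open>X * X\<close> vanishes, the left factor cancels the summand
    \<open>X\<close> at the cost of \<open>- X * Y\<close>.\<close>
  have "(1\<^sub>m n - X) * (1\<^sub>m n + X + Y) = (1\<^sub>m n + X + Y) - X * (1\<^sub>m n + X + Y)"
    using X Y by (subst minus_mult_distrib_mat[of _ n n]) auto
  also have "X * (1\<^sub>m n + X + Y) = X + X * Y"
    using X Y by (subst mult_add_distrib_mat[of _ n n _ n], simp_all, subst mult_add_distrib_mat[of _ n n _ n])
      (simp_all add: XX)
  also have "(1\<^sub>m n + X + Y) - (X + X * Y) = 1\<^sub>m n + Y - X * Y"
    using X Y by (intro eq_matI) auto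
  finally have 1: "(1\<^sub>m n - X) * (1\<^sub>m n + X + Y) = 1\<^sub>m n + Y - X * Y" .
  \<comment> \<open>The right factor leaves \<open>X * Y\<close> unchanged, because
    \<open>Y * Y\<close> vanishes, and turns I + Y into I.\<close>
  have "X * Y * Y = 0\<^sub>m n n"
    using X Y by (simp add: assoc_mult_mat[of _ n n _ n _ n] YY)
  then have XYY: "X * Y * (1\<^sub>m n - Y) = X * Y"
    using X Y XY by (subst mult_minus_distrib_mat[of _ n n]) auto
  have "(1\<^sub>m n + Y - X * Y) * (1\<^sub>m n - Y) = (1\<^sub>m n + Y) * (1\<^sub>m n - Y) - X * Y * (1\<^sub>m n - Y)"
    using X Y XY by (subst minus_mult_distrib_mat[of _ n n]) (auto simp: minus_carrier_mat)
  also have "\<dots> = 1\<^sub>m n - X * Y"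
    unfolding XYY one_add_mult_one_minus_mat[OF Y YY] ..
  finally have prod: "det ((1\<^sub>m n - X) * (1\<^sub>m n + X + Y) * (1\<^sub>m n - Y)) = det (1\<^sub>m n - X * Y)"
    unfolding 1 by simp
  have mX: "1\<^sub>m n - X \<in> carrier_mat n n" and mY: "1\<^sub>m n - Y \<in> carrier_mat n n"
    and S: "1\<^sub>m n + X + Y \<in> carrier_mat n n"
    using X Y by (auto simp: minus_carrier_mat)
  have "det ((1\<^sub>m n - X) * (1\<^sub>m n + X + Y) * (1\<^sub>m n - Y))
      = det (1\<^sub>m n - X) * det (1\<^sub>m n + X + Y) * det (1\<^sub>m n - Y)"
    using det_mult[OF mult_carrier_mat[OF mX S] mY] det_mult[OF mX S] by simp
  then show ?thesis using prod by (simp add: inv[OF X XX] inv[OF Y YY])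
qed

text \<open>Dividing by \<open>t\<close> reduces to the previous lemma with X = -(u/t) N and Y =
  -(v/t) M, and X Y sees the scalars only through u v. Keeping \<open>t\<close> as a coefficient
  lets both sides of the theorem be matched without denominators.\<close>

lemma det_square_zero_pencil:
  fixes N M :: "'a :: field mat"
  assumes N: "N \<in> carrier_mat n n" and NN: "N * N = 0\<^sub>m n n"
    and M: "M \<in> carrier_mat n n" and MM: "M * M = 0\<^sub>m n n"
    and t: "t \<noteq> 0" and ab: "a * b = c * d"
  shows "det (t \<cdot>\<^sub>m 1\<^sub>m n - a \<cdot>\<^sub>m N - b \<cdot>\<^sub>m M) = det (t \<cdot>\<^sub>m 1\<^sub>m n - c \<cdot>\<^sub>m N - d \<cdot>\<^sub>m M)"
proof -
  have smult_mult: "(u \<cdot>\<^sub>m P) * (v \<cdot>\<^sub>m Q) = (u * v) \<cdot>\<^sub>m (P * Q)"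
    if "P \<in> carrier_mat n n" "Q \<in> carrier_mat n n" for P Q :: "'a mat" and u v
    using that by (intro eq_matI)
      (auto simp: mult_smult_assoc_mat[of _ n n _ n] mult_smult_distrib[of _ n n _ n])
  have red: "det (t \<cdot>\<^sub>m 1\<^sub>m n - u \<cdot>\<^sub>m N - v \<cdot>\<^sub>m M) = t ^ n * det (1\<^sub>m n - (u * v / t\<^sup>2) \<cdot>\<^sub>m (N * M))"
    for u v
  proof -
    let ?X = "(- u / t) \<cdot>\<^sub>m N" and ?Y = "(- v / t) \<cdot>\<^sub>m M"
    have "t \<cdot>\<^sub>m 1\<^sub>m n - u \<cdot>\<^sub>m N - v \<cdot>\<^sub>m M = t \<cdot>\<^sub>m (1\<^sub>m n + ?X + ?Y)"
      using N M t by (intro eq_matI) (auto simp: field_simps)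
    then have "det (t \<cdot>\<^sub>m 1\<^sub>m n - u \<cdot>\<^sub>m N - v \<cdot>\<^sub>m M) = t ^ n * det (1\<^sub>m n + ?X + ?Y)"
      using M by simp
    also have "det (1\<^sub>m n + ?X + ?Y) = det (1\<^sub>m n - ?X * ?Y)"
      using N M by (intro det_one_add_two_square_zero) (simp_all add: smult_mult NN MM)
    also have "?X * ?Y = (u * v / t\<^sup>2) \<cdot>\<^sub>m (N * M)"
      using N M by (simp add: smult_mult power2_eq_square)
    finally show ?thesis .
  qed
  show ?thesis unfolding red ab ..
qed

text \<open>The embedding of F into F(x); it carries \<open>N\<close> and its transpose, with their
  vanishing squares, to matrices over F(x).\<close>

lemma comm_ring_hom_const_fract: "comm_ring_hom (\<lambda>a :: 'a :: field. to_fract [:a:])"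
proof
  fix a b :: 'a
  show "to_fract [:a + b:] = to_fract [:a:] + to_fract [:b:]"
    by (simp flip: to_fract_add)
  show "to_fract [:a * b:] = to_fract [:a:] * to_fract [:b:]"
    by (simp flip: to_fract_mult)
qed (simp_all flip: one_pCons)

text \<open>Being a ring homomorphism, substitution can be moved inside the determinants that define
  \<open>phi\<close> and \<open>char_poly\<close>.\<close>

lemma comm_ring_hom_subst_ratfun: "comm_ring_hom (\<lambda>p :: 'a :: field poly. subst_ratfun p u)"
proof -
  interpret h: comm_ring_hom "\<lambda>a :: 'a. to_fract [:a:]"
    by (rule comm_ring_hom_const_fract)
  interpret H: map_poly_comm_ring_hom "\<lambda>a :: 'a. to_fract [:a:]" ..
  show ?thesis
    by unfold_locales (simp_all add: subst_ratfun_def H.hom_add H.hom_mult)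
qed

lemma subst_ratfun_pCons [simp]:
  "subst_ratfun (pCons a p) u = to_fract [:a:] + u * subst_ratfun p u"
proof -
  interpret h: comm_ring_hom "\<lambda>a :: 'a. to_fract [:a:]"
    by (rule comm_ring_hom_const_fract)
  show ?thesis by (simp add: subst_ratfun_def h.map_poly_pCons_hom)
qed

lemma subst_ratfun_0 [simp]: "subst_ratfun 0 u = 0"
  by (simp add: subst_ratfun_def)

lemma ratfun_X_neq_0: "ratfun_X \<noteq> 0"
  by (simp add: ratfun_X_def)

text \<open>This holds in every characteristic, since the polynomial has leading coefficient 1; its
  possible roots in F do not matter.\<close>

lemma ratfun_X_square_add_1_neq_0: "ratfun_X ^ 2 + 1 \<noteq> 0"
proof -
  have "ratfun_X ^ 2 + 1 = to_fract ([:1, 0, 1:] :: 'a poly)"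
    by (simp add: ratfun_X_def power2_eq_square one_pCons flip: to_fract_mult to_fract_add to_fract_1)
  then show ?thesis by simp
qed

theorem theorem3p8:
  fixes N C A :: "'a :: field mat" and n :: nat
  assumes "n \<ge> 1"
    and "N \<in> carrier_mat n n"
    and "N * N = 0\<^sub>m n n"
    and "C = 1\<^sub>m n - N"
    and "A = N + transpose_mat N"
  shows "subst_ratfun (phi C) (ratfun_X ^ 2)
       = ratfun_X ^ n * subst_ratfun (char_poly A) (ratfun_X + inverse ratfun_X)"
proof -
  interpret h: comm_ring_hom "\<lambda>a :: 'a. to_fract [:a:]"
    by (rule comm_ring_hom_const_fract)
  let ?x = "ratfun_X :: 'a poly fract"
  let ?s = "?x + inverse ?x" and ?t = "?x ^ 2 + 1"
  let ?N = "map_mat (\<lambda>a. to_fract [:a:]) N" and ?M = "map_mat (\<lambda>a. to_fract [:a:]) N\<^sup>T"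
  interpret S: comm_ring_hom "\<lambda>p :: 'a poly. subst_ratfun p (?x ^ 2)"
    by (rule comm_ring_hom_subst_ratfun)
  interpret T: comm_ring_hom "\<lambda>p :: 'a poly. subst_ratfun p ?s"
    by (rule comm_ring_hom_subst_ratfun)
  note N = assms(2)
  have M: "N\<^sup>T \<in> carrier_mat n n" using N by simp
  have MM: "N\<^sup>T * N\<^sup>T = 0\<^sub>m n n"
    using transpose_mult[OF N N] by (simp add: assms(3))
  have NNx: "?N * ?N = 0\<^sub>m n n"
    unfolding h.mat_hom_mult[OF N N, symmetric] assms(3) by (intro eq_matI) auto
  have MMx: "?M * ?M = 0\<^sub>m n n"
    unfolding h.mat_hom_mult[OF M M, symmetric] MM by (intro eq_matI) auto
  \<comment> \<open>Entrywise, x^2 (I - N) + (I - N^T) = (x^2 + 1) I - x^2 N - N^T; the explicit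
    factor 1 fits the shape of the pencil.\<close>
  have "subst_ratfun (phi C) (?x ^ 2) = det (?t \<cdot>\<^sub>m 1\<^sub>m n - ?x ^ 2 \<cdot>\<^sub>m ?N - 1 \<cdot>\<^sub>m ?M)"
    unfolding phi_def S.hom_det[symmetric] using N assms(4)
    by (intro arg_cong[where f = det] eq_matI)
      (auto simp: S.hom_add S.hom_mult h.hom_minus h.hom_uminus algebra_simps)
  \<comment> \<open>The coefficient pairs (x^2, 1) and (x, x) have the same product.\<close>
  also have "\<dots> = det (?t \<cdot>\<^sub>m 1\<^sub>m n - ?x \<cdot>\<^sub>m ?N - ?x \<cdot>\<^sub>m ?M)"
    using N by (intro det_square_zero_pencil NNx MMx ratfun_X_square_add_1_neq_0)
      (auto simp: power2_eq_square)
  \<comment> \<open>Since x (x + 1/x) = x^2 + 1, a factor x comes out of the whole matrix; the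
    determinant then contributes x^n.\<close>
  also have "?t \<cdot>\<^sub>m 1\<^sub>m n - ?x \<cdot>\<^sub>m ?N - ?x \<cdot>\<^sub>m ?M
      = ?x \<cdot>\<^sub>m map_mat (\<lambda>p. subst_ratfun p ?s) (char_poly_matrix A)"
    unfolding char_poly_matrix_def using N assms(5) ratfun_X_neq_0[where 'a = 'a]
    by (intro eq_matI)
      (auto simp: T.hom_add T.hom_mult h.hom_minus h.hom_add h.hom_uminus algebra_simps power2_eq_square)
  also have "det \<dots> = ?x ^ n * subst_ratfun (char_poly A) ?s"
    unfolding char_poly_def T.hom_det[symmetric] using N assms(5)
    by (simp add: char_poly_matrix_def)
  finally show ?thesis .
qed

end
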